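(* Let $Y$ be a random variable whose moment generating function $E[e^{tY}]$ exists for $|t|<\delta$ for some $\delta>0$. Let $(Y_j)_{j\ge1}$ be mutually independent copies of $Y$, $S_0=0$, $S_k=Y_1+\cdots+Y_k$ for $k\ge1$. Let $r$ be a positive integer and for $k\ge0$ define the probabilistic $r$-Stirling numbers of the second kind ${n+r\brace k+r}_{r,Y}$ ($n\ge k$) by $$\frac{1}{k!}\big(E[e^{tY}]-1\big)^k e^{rt}=\sum_{n=k}^{\infty}{n+r\brace k+r}_{r,Y}\frac{t^n}{n!}.$$ Then for all integers $n\ge k\ge0$, $${n+r\brace k+r}_{r,Y}=\frac{1}{k!}\sum_{j=0}^{k}\binom{k}{j}(-1)^{k-j}E\big[(S_j+r)^n\big].$$
   Context: $E$ denotes mathematical expectation. *)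

theory Defs
  imports "HOL-Probability.Probability"
begin

text \<open>
  \<open>prob_r_stirling2 M Y r n k\<close> is the probabilistic \<open>r\<close>-Stirling number of the second kind with
  upper entry \<open>n + r\<close> and lower entry \<open>k + r\<close>: its arguments are \<open>n\<close> and \<open>k\<close>, not the entries
  themselves. The generating function identity is read as an identity of functions of real \<open>t\<close>
  near \<open>0\<close>. Since its series starts at \<open>n = k\<close>, the values for \<open>n < k\<close> are fixed to be \<open>0\<close>.
\<close>

definition prob_r_stirling2 ::
    "'a measure \<Rightarrow> ('a \<Rightarrow> real) \<Rightarrow> nat \<Rightarrow> nat \<Rightarrow> nat \<Rightarrow> real" where
  "prob_r_stirling2 M Y r n k =
    (THE a :: nat \<Rightarrow> real.
       (\<forall>m<k. a m = 0) \<and>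
       (\<exists>\<epsilon>>0. \<forall>t. \<bar>t\<bar> < \<epsilon> \<longrightarrow>
          (\<lambda>m. a m * (t ^ m / fact m)) sums
            (1 / fact k * (prob_space.expectation M (\<lambda>\<omega>. exp (t * Y \<omega>)) - 1) ^ k
              * exp (real r * t)))) n"

end

theory Submission
  imports Defs "HOL-Complex_Analysis.Laurent_Convergence"
begin

text \<open>
  Near \<open>0\<close>, dominated convergence expands \<open>E[exp (t X)]\<close> into the exponential generating function
  of the moments \<open>E[X^n]\<close>. By independence \<open>E[exp (t Y)]^j * exp (r t) = E[exp (t (S_j + r))]\<close>,
  so the binomial theorem applied to \<open>(E[exp (t Y)] - 1)^k\<close> expresses the defining function as a
  combination of moment generating functions, and uniqueness of real power series allows to compare
  coefficients. Since \<open>E[exp (t Y)] - 1\<close> has no constant term, the coefficients below \<open>k\<close> vanish.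
\<close>

text \<open>Zeros of a nonzero power series are isolated. The difference \<open>D\<close> of two
  expansions of \<open>f\<close> represents the zero function near 0, so a nonzero coefficient of
  \<open>D\<close> would contradict this.\<close>

lemma has_fps_expansion_unique:
  fixes F G :: "'a :: {banach, real_normed_field} fps"
  assumes "f has_fps_expansion F" "f has_fps_expansion G"
  shows "F = G"
proof (rule ccontr)
  assume "F \<noteq> G"
  define D where "D = F - G"
  from \<open>F \<noteq> G\<close> obtain m where m: "fps_nth D m \<noteq> 0"
    by (auto simp: D_def fps_eq_iff)
  have D: "(\<lambda>_. 0) has_fps_expansion D"
    using has_fps_expansion_diff[OF assms] by (simp add: D_def)
  then have radius: "fps_conv_radius D > 0"
    and "eventually (\<lambda>z. eval_fps D z = 0) (nhds 0)"
    by (auto simp: has_fps_expansion_def)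
  then obtain d where d: "d > 0" "\<And>z. norm z < d \<Longrightarrow> eval_fps D z = 0"
    by (auto simp: eventually_nhds_metric)
  from radius obtain \<rho> where \<rho>: "\<rho> > 0" "ereal \<rho> < fps_conv_radius D"
    using ereal_dense2[OF radius] by auto
  have sums: "(\<lambda>n. fps_nth D n * (z - 0) ^ n) sums eval_fps D z" if "norm (z - 0) < \<rho>" for z
    using sums_eval_fps[of z D] that \<rho>(2) less_trans[of "ereal (norm z)" "ereal \<rho>"] by simp
  have "eval_fps D 0 = 0" using d by simp
  \<comment> \<open>\<open>powser_0_nonzero\<close> wants a zero at the centre and a nonzero
    coefficient of positive index; the constant coefficient is \<open>eval_fps D 0\<close>, hence
    zero.\<close>
  moreover from this m have "m > 0"
    by (intro gr0I) (auto simp: eval_fps_at_0)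
  ultimately obtain s where s: "0 < s" "\<And>z. z \<in> cball 0 s - {0} \<Longrightarrow> eval_fps D z \<noteq> 0"
    using powser_0_nonzero[OF \<rho>(1) sums _ m] by blast
  \<comment> \<open>A nonzero point lying both in the ball of radius \<open>d\<close>, where
    \<open>D\<close> vanishes, and in the ball of radius \<open>s\<close>, where it vanishes only at
    0. Halving \<open>d\<close> makes the first bound strict.\<close>
  define z :: 'a where "z = of_real (min s (d / 2))"
  have "norm z = min s (d / 2)" "z \<noteq> 0"
    using s(1) d(1) by (auto simp: z_def min_def)
  then show False
    using s(2)[of z] d(2)[of z] d(1) by auto
qed

lemma sums_imp_has_fps_expansion:
  fixes f :: "real \<Rightarrow> real"
  assumes "\<epsilon> > 0" and sums: "\<And>t. \<bar>t\<bar> < \<epsilon> \<Longrightarrow> (\<lambda>n. c n * t ^ n) sums f t"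
  shows "f has_fps_expansion Abs_fps c"
proof -
  have "ereal \<epsilon> \<le> conv_radius c"
    using sums_summable[OF sums] by (intro conv_radius_geI_ex') auto
  then have "fps_conv_radius (Abs_fps c) > 0"
    using \<open>\<epsilon> > 0\<close> by (simp add: fps_conv_radius_def less_le_trans[of 0 "ereal \<epsilon>"])
  moreover have "eventually (\<lambda>t. eval_fps (Abs_fps c) t = f t) (nhds 0)"
    unfolding eventually_nhds_metric
    using \<open>\<epsilon> > 0\<close> sums by (intro exI[of _ \<epsilon>]) (auto simp: eval_fps_def sums_iff)
  ultimately show ?thesis by (simp add: has_fps_expansion_def)
qed

text \<open>Dominated convergence for the partial sums of the exponential series. Integrability is
  assumed at both \<open>t\<close> and \<open>- t\<close> because the dominating function
  \<open>w\<close> has to bound \<open>exp \<bar>t * X \<omega>\<bar>\<close>, whatever the sign of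
  \<open>X \<omega>\<close>.\<close>

lemma sums_moments:
  fixes X :: "'a \<Rightarrow> real"
  assumes [measurable]: "X \<in> borel_measurable M"
    and int: "integrable M (\<lambda>\<omega>. exp (t * X \<omega>))" "integrable M (\<lambda>\<omega>. exp (- t * X \<omega>))"
  shows "(\<lambda>n. \<integral>\<omega>. (t * X \<omega>) ^ n / fact n \<partial>M) sums (\<integral>\<omega>. exp (t * X \<omega>) \<partial>M)"
proof -
  define w where "w \<omega> = exp (t * X \<omega>) + exp (- t * X \<omega>)" for \<omega>
  have w: "integrable M w" unfolding w_def using int by (rule Bochner_Integration.integrable_add)
  have exp_sums: "(\<lambda>n. x ^ n / fact n) sums exp x" for x :: real
    using exp_converges[of x] by (simp add: field_simps)
  have exp_abs_le: "exp \<bar>t * X \<omega>\<bar> \<le> w \<omega>" for \<omega>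
    by (cases "t * X \<omega> \<ge> 0") (auto simp: w_def)
  \<comment> \<open>Used twice: a singleton \<open>A\<close> gives integrability of each term, an
    initial segment gives the domination of the partial sums.\<close>
  have sum_le: "(\<Sum>i\<in>A. \<bar>t * X \<omega>\<bar> ^ i / fact i) \<le> w \<omega>" if "finite A" for A \<omega>
    using sum_le_suminf[OF sums_summable[OF exp_sums[of "\<bar>t * X \<omega>\<bar>"]] that]
      sums_unique[OF exp_sums[of "\<bar>t * X \<omega>\<bar>"]] exp_abs_le[of \<omega>] by simp
  have *: "integrable M (\<lambda>\<omega>. (t * X \<omega>) ^ n / fact n)" for n
  proof (rule Bochner_Integration.integrable_bound[OF w])
    show "AE \<omega> in M. norm ((t * X \<omega>) ^ n / fact n) \<le> norm (w \<omega>)"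
      using sum_le[of "{n}"] by (intro AE_I2) (force simp: power_abs w_def)
  qed measurable
  have "(\<lambda>N. \<integral>\<omega>. (\<Sum>n<N. (t * X \<omega>) ^ n / fact n) \<partial>M) \<longlonglongrightarrow> (\<integral>\<omega>. exp (t * X \<omega>) \<partial>M)"
  proof (rule integral_dominated_convergence[OF _ _ w])
    show "AE \<omega> in M. (\<lambda>N. \<Sum>n<N. (t * X \<omega>) ^ n / fact n) \<longlonglongrightarrow> exp (t * X \<omega>)"
      using exp_sums by (simp add: sums_def)
    show "AE \<omega> in M. norm (\<Sum>n<N. (t * X \<omega>) ^ n / fact n) \<le> w \<omega>" for N
    proof (rule AE_I2)
      fix \<omega>
      have "norm (\<Sum>n<N. (t * X \<omega>) ^ n / fact n) \<le> (\<Sum>n<N. \<bar>t * X \<omega>\<bar> ^ n / fact n)"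
        by (rule order.trans[OF norm_sum]) (simp add: power_abs)
      also have "\<dots> \<le> w \<omega>" by (rule sum_le) simp
      finally show "norm (\<Sum>n<N. (t * X \<omega>) ^ n / fact n) \<le> w \<omega>" .
    qed
  qed measurable
  then show "(\<lambda>n. \<integral>\<omega>. (t * X \<omega>) ^ n / fact n \<partial>M) sums (\<integral>\<omega>. exp (t * X \<omega>) \<partial>M)"
    unfolding sums_def using * by (simp add: Bochner_Integration.integral_sum)
qed

lemma mgf_has_fps_expansion:
  fixes X :: "'a \<Rightarrow> real"
  assumes "X \<in> borel_measurable M" "\<delta> > 0"
    and int: "\<And>t. \<bar>t\<bar> < \<delta> \<Longrightarrow> integrable M (\<lambda>\<omega>. exp (t * X \<omega>))"
  shows "(\<lambda>t. \<integral>\<omega>. exp (t * X \<omega>) \<partial>M) has_fps_expansion Abs_fps (\<lambda>n. (\<integral>\<omega>. X \<omega> ^ n \<partial>M) / fact n)"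
proof (rule sums_imp_has_fps_expansion[OF \<open>\<delta> > 0\<close>])
  fix t :: real assume t: "\<bar>t\<bar> < \<delta>"
  have "(\<integral>\<omega>. (t * X \<omega>) ^ n / fact n \<partial>M) = (\<integral>\<omega>. X \<omega> ^ n \<partial>M) / fact n * t ^ n" for n
  proof -
    have "(\<integral>\<omega>. (t * X \<omega>) ^ n / fact n \<partial>M) = (\<integral>\<omega>. (t ^ n / fact n) * X \<omega> ^ n \<partial>M)"
      by (simp add: power_mult_distrib)
    then show ?thesis by simp
  qed
  then show "(\<lambda>n. (\<integral>\<omega>. X \<omega> ^ n \<partial>M) / fact n * t ^ n) sums (\<integral>\<omega>. exp (t * X \<omega>) \<partial>M)"
    using sums_moments[OF assms(1) int int, of t] t by simp
qed

text \<open>The exponential turns the sum into a product of independent factors, and the expectation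
  of each factor depends only on the common law. An empty \<open>I\<close> is allowed and covers the
  case of \<open>S_0\<close>.\<close>

lemma (in prob_space)
  fixes Y :: "'a \<Rightarrow> real" and Ys :: "'i \<Rightarrow> 'a \<Rightarrow> real"
  assumes Y: "Y \<in> borel_measurable M"
    and int: "integrable M (\<lambda>\<omega>. exp (t * Y \<omega>))"
    and indep: "indep_vars (\<lambda>_. borel) Ys I" and "finite I"
    and distr: "\<And>i. i \<in> I \<Longrightarrow> distr M borel (Ys i) = distr M borel Y"
  shows integrable_exp_iid_sum: "integrable M (\<lambda>\<omega>. exp (t * (\<Sum>i\<in>I. Ys i \<omega>)))"
    and expectation_exp_iid_sum:
      "expectation (\<lambda>\<omega>. exp (t * (\<Sum>i\<in>I. Ys i \<omega>))) = expectation (\<lambda>\<omega>. exp (t * Y \<omega>)) ^ card I"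
proof -
  have Ys: "Ys i \<in> borel_measurable M" if "i \<in> I" for i
    using indep that by (auto simp: indep_vars_def)
  have ind: "indep_vars (\<lambda>_. borel) (\<lambda>i \<omega>. exp (t * Ys i \<omega>)) I"
    by (rule indep_vars_compose2[OF indep]) measurable
  have int_i: "integrable M (\<lambda>\<omega>. exp (t * Ys i \<omega>))" if "i \<in> I" for i
    using int integrable_distr_eq[OF Y, of "\<lambda>x. exp (t * x)"]
      integrable_distr_eq[OF Ys[OF that], of "\<lambda>x. exp (t * x)"] distr[OF that] by simp
  have exp_i: "expectation (\<lambda>\<omega>. exp (t * Ys i \<omega>)) = expectation (\<lambda>\<omega>. exp (t * Y \<omega>))"
    if "i \<in> I" for i
    using integral_distr[OF Y, of "\<lambda>x. exp (t * x)"]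
      integral_distr[OF Ys[OF that], of "\<lambda>x. exp (t * x)"] distr[OF that] by simp
  have eq: "exp (t * (\<Sum>i\<in>I. Ys i \<omega>)) = (\<Prod>i\<in>I. exp (t * Ys i \<omega>))" for \<omega>
    by (simp add: sum_distrib_left exp_sum \<open>finite I\<close>)
  show "integrable M (\<lambda>\<omega>. exp (t * (\<Sum>i\<in>I. Ys i \<omega>)))"
    unfolding eq using \<open>finite I\<close> ind int_i by (rule indep_vars_integrable)
  show "expectation (\<lambda>\<omega>. exp (t * (\<Sum>i\<in>I. Ys i \<omega>))) = expectation (\<lambda>\<omega>. exp (t * Y \<omega>)) ^ card I"
    unfolding eq using indep_vars_lebesgue_integral[OF \<open>finite I\<close> ind int_i] exp_i by simp
qed

text \<open>Discharges the definite description: any expansion \<open>G\<close> of the generating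
  function yields a witness, and uniqueness of expansions makes it the only one. The factor
  \<open>fact n\<close> passes from ordinary to exponential coefficients.\<close>

lemma prob_r_stirling2_eqI:
  assumes "\<And>m. m < k \<Longrightarrow> fps_nth G m = 0"
    and G: "(\<lambda>t. 1 / fact k * (prob_space.expectation M (\<lambda>\<omega>. exp (t * Y \<omega>)) - 1) ^ k
              * exp (real r * t)) has_fps_expansion G" (is "?f has_fps_expansion _")
  shows "prob_r_stirling2 M Y r n k = fact n * fps_nth G n"
proof -
  have radius: "fps_conv_radius G > 0" and "eventually (\<lambda>t. eval_fps G t = ?f t) (nhds 0)"
    using G by (auto simp: has_fps_expansion_def)
  then obtain d where d: "d > 0" "\<And>t. \<bar>t\<bar> < d \<Longrightarrow> eval_fps G t = ?f t"
    by (auto simp: eventually_nhds_metric)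
  obtain \<rho> where \<rho>: "\<rho> > 0" "ereal \<rho> < fps_conv_radius G"
    using ereal_dense2[OF radius] by auto
  \<comment> \<open>Below \<open>\<rho>\<close> the series converges; below \<open>d\<close> its
    value is the generating function.\<close>
  have "(\<lambda>m. fact m * fps_nth G m * (t ^ m / fact m)) sums ?f t" if "\<bar>t\<bar> < min d \<rho>" for t
    using sums_eval_fps[of t G] that \<rho>(2) less_trans[of "ereal \<bar>t\<bar>" "ereal \<rho>"] d(2)[of t] by simp
  then have ex: "\<exists>\<epsilon>>0. \<forall>t. \<bar>t\<bar> < \<epsilon> \<longrightarrow> (\<lambda>m. fact m * fps_nth G m * (t ^ m / fact m)) sums ?f t"
    using d(1) \<rho>(1) by (intro exI[of _ "min d \<rho>"]) auto
  have unique: "a = (\<lambda>m. fact m * fps_nth G m)"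
    if "\<epsilon> > 0" "\<And>t. \<bar>t\<bar> < \<epsilon> \<Longrightarrow> (\<lambda>m. a m * (t ^ m / fact m)) sums ?f t" for a \<epsilon>
  proof -
    have "?f has_fps_expansion Abs_fps (\<lambda>m. a m / fact m)"
      using that by (intro sums_imp_has_fps_expansion[of \<epsilon>]) simp_all
    then have "G = Abs_fps (\<lambda>m. a m / fact m)"
      by (rule has_fps_expansion_unique[OF G])
    then show ?thesis by auto
  qed
  show ?thesis
    unfolding prob_r_stirling2_def
    by (rule the_equality[THEN fun_cong]) (use assms(1) ex unique in auto)
qed

theorem theorem2p1:
  fixes M :: "'a measure" and Y :: "'a \<Rightarrow> real" and Ys :: "nat \<Rightarrow> 'a \<Rightarrow> real"
    and \<delta> :: real and r n k :: nat
  assumes "prob_space M"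
    and "Y \<in> borel_measurable M"
    and "\<delta> > 0"
    and "\<And>t. \<bar>t\<bar> < \<delta> \<Longrightarrow> integrable M (\<lambda>\<omega>. exp (t * Y \<omega>))"
    and "prob_space.indep_vars M (\<lambda>_. borel) Ys {1..}"
    and "\<And>j. j \<ge> 1 \<Longrightarrow> distr M borel (Ys j) = distr M borel Y"
    and "r \<ge> 1"
    and "k \<le> n"
  shows "prob_r_stirling2 M Y r n k =
    1 / fact k * (\<Sum>j=0..k. real (k choose j) * (-1) ^ (k - j) *
      prob_space.expectation M (\<lambda>\<omega>. ((\<Sum>i=1..j. Ys i \<omega>) + real r) ^ n))"
proof -
  interpret prob_space M by fact
  define \<phi> where "\<phi> t = expectation (\<lambda>\<omega>. exp (t * Y \<omega>))" for t
  define X where "X j \<omega> = (\<Sum>i=1..j. Ys i \<omega>) + real r" for j \<omega>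
  define f where "f t = 1 / fact k * (\<phi> t - 1) ^ k * exp (real r * t)" for t

  have indep: "indep_vars (\<lambda>_. borel) Ys {1..j}" for j
    using assms(5) by (rule indep_vars_subset) auto
  have X_measurable: "X j \<in> borel_measurable M" for j
    using indep[of j] unfolding X_def
    by (intro borel_measurable_add borel_measurable_sum) (auto simp: indep_vars_def)
  have exp_X: "exp (t * X j \<omega>) = exp (real r * t) * exp (t * (\<Sum>i=1..j. Ys i \<omega>))" for t j \<omega>
    by (simp add: X_def ring_distribs exp_add mult.commute)
  have X_integrable: "integrable M (\<lambda>\<omega>. exp (t * X j \<omega>))" if "\<bar>t\<bar> < \<delta>" for t j
    unfolding exp_X
    using integrable_exp_iid_sum[OF assms(2) assms(4)[OF that] indep] assms(6) by simp
  have X_mgf: "expectation (\<lambda>\<omega>. exp (t * X j \<omega>)) = exp (real r * t) * \<phi> t ^ j"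
    if "\<bar>t\<bar> < \<delta>" for t j
    unfolding exp_X \<phi>_def
    using expectation_exp_iid_sum[OF assms(2) assms(4)[OF that] indep, of j] assms(6) by simp

  define F where "F = Abs_fps (\<lambda>n. expectation (\<lambda>\<omega>. Y \<omega> ^ n) / fact n)"
  \<comment> \<open>\<open>G\<close> comes from the closed form of \<open>f\<close>, and
    \<open>H\<close> below from its binomial expansion into moment generating functions of the
    \<open>X j\<close>. The claim is the equality of their coefficients.\<close>
  define G where "G = fps_const (1 / fact k) * (F - 1) ^ k * fps_exp (real r)"
  define H where "H = (\<Sum>j=0..k. fps_const (1 / fact k * (real (k choose j) * (-1) ^ (k - j))) *
    Abs_fps (\<lambda>n. expectation (\<lambda>\<omega>. X j \<omega> ^ n) / fact n))"

  have "\<phi> has_fps_expansion F"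
    unfolding \<phi>_def F_def using assms(2-4) by (rule mgf_has_fps_expansion)
  then have G: "f has_fps_expansion G"
    unfolding f_def G_def by (intro fps_expansion_intros)
  \<comment> \<open>The zeroth moment is the total mass 1.\<close>
  have "(F - 1) $ 0 = 0"
    by (simp add: F_def prob_space)
  \<comment> \<open>The coefficient of index \<open>m\<close> of the product with
    \<open>fps_exp\<close> involves only coefficients of \<open>(F - 1) ^ k\<close> of index at most
    \<open>m\<close>, all zero.\<close>
  then have G_0: "G $ m = 0" if "m < k" for m
    unfolding G_def using that startsby_zero_power_prefix[of "F - 1" k]
    by (simp add: mult.assoc fps_mult_nth)

  have "(\<lambda>t. \<Sum>j=0..k. 1 / fact k * (real (k choose j) * (-1) ^ (k - j)) *
      expectation (\<lambda>\<omega>. exp (t * X j \<omega>))) has_fps_expansion H"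
    unfolding H_def
    by (intro has_fps_expansion_sum has_fps_expansion_cmult_left
        mgf_has_fps_expansion[OF X_measurable assms(3) X_integrable])
  \<comment> \<open>The two functions are compared only for \<open>\<bar>t\<bar> < \<delta>\<close>,
    where integrability lets \<open>X_mgf\<close> factor the expectations; a neighbourhood of 0
    suffices for equal expansions.\<close>
  moreover have "eventually (\<lambda>t. (\<Sum>j=0..k. 1 / fact k * (real (k choose j) * (-1) ^ (k - j)) *
      expectation (\<lambda>\<omega>. exp (t * X j \<omega>))) = f t) (nhds 0)"
    unfolding eventually_nhds_metric
  proof (intro exI[of _ \<delta>] conjI allI impI)
    fix t :: real assume "dist t 0 < \<delta>"
    then have t: "\<bar>t\<bar> < \<delta>" by simp
    have "(\<phi> t - 1) ^ k = (\<Sum>j=0..k. real (k choose j) * \<phi> t ^ j * (-1) ^ (k - j))"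
      using binomial_ring[of "\<phi> t" "-1" k] by (simp add: atLeast0AtMost)
    then show "(\<Sum>j=0..k. 1 / fact k * (real (k choose j) * (-1) ^ (k - j)) *
        expectation (\<lambda>\<omega>. exp (t * X j \<omega>))) = f t"
      by (simp add: f_def X_mgf[OF t] sum_distrib_left sum_distrib_right mult_ac)
  qed fact
  ultimately have "f has_fps_expansion H"
    by (rule has_fps_expansion_cong[OF _ refl, THEN iffD1, rotated])
  with G have "G = H" by (rule has_fps_expansion_unique)

  have "prob_r_stirling2 M Y r n k = fact n * H $ n"
    using prob_r_stirling2_eqI[OF G_0 G[unfolded f_def \<phi>_def]] \<open>G = H\<close> by simp
  also have "\<dots> = 1 / fact k * (\<Sum>j=0..k. real (k choose j) * (-1) ^ (k - j) *
      expectation (\<lambda>\<omega>. X j \<omega> ^ n))"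
    by (simp add: H_def fps_sum_nth sum_distrib_left mult_ac)
  finally show ?thesis unfolding X_def .
qed

end
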